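(* Let $\Omega$ be as described in the context and let $(S^k)_{k\ge0}$ be a sequence generated by the accelerated geometric DC algorithm (described in the context). Let $S^*\in\overline{\mathcal W}$ be a limit point of $(S^k)_{k\ge0}$ that is an equilibrium of the flow $\dot S=R_S(\Omega S)$ and satisfies $$(\Omega S^* )_j(x)-(\Omega S^* )_{j^*(x)}(x)<0\qquad\text{for all }j\in\{1,\dots,c\}\setminus\{j^*(x)\},\ j^*(x)=\arg\max_{l}S^*_l(x),\quad\forall x\in\mathcal V$$ (so that $S^*(x)=e_{j^*(x)}$ is a unit vector for each $x$), and let $$\varepsilon^*=\min_{x\in\mathcal V}\min_{j\ne j^*(x)}\frac{2\big((\Omega S^* )_{j^*(x)}-(\Omega S^* )_j\big)(x)}{\sum_{y\in\mathcal N(x)}\Omega(x,y)+\big((\Omega S^* )_{j^*(x)}-(\Omega S^* )_j\big)(x)}>0 .$$ Introduce the positive constants $$\overline h=\max_{k\in\mathbb N}h_k,\qquad\rho^*=\max_{S\in\overline{\mathcal W}}\ \max_{x\in\mathcal V,\,j\ne j^*(x)}\big((\Omega S)_{j^*(x)}-(\Omega S)_j\big)(x),\qquad N=\max_{y\in\mathcal V}|\mathcal N(y)| .$$ Then for all $\varepsilon>0$ small enough such that $$\varepsilon\le\min_{x\in\mathcal V}\min_{j\ne j^*(x)}\frac{2\big((\Omega S^* )_{j^*(x)}-(\Omega S^* )_j\big)(x)}{1+C\rho^*+\big((\Omega S^* )_{j^*(x)}-(\Omega S^* )_j\big)(x)},\qquad C=\overline h\cdot c\cdot N,$$ the following applies: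 if for some index $k_0\in\mathbb N$ it holds that $S^{k_0}\in B_\varepsilon(S^* )\subset B_{\varepsilon^*}(S^* )$, then for all $k>k_0$ there exists a mapping $\xi\colon\mathcal V\to\mathbb R$ with $\xi(x)\in(0,1)$ for all $x\in\mathcal V$, such that $$\|S^k(x)-S^*(x)\|_1<\xi^{k-k_0}(x)\,\|S^{k_0}(x)-S^*(x)\|_1,\qquad\forall x\in\mathcal V .$$
   Context: $\mathcal V\subset\mathbb Z^d$ ($d\ge2$) is a finite vertex set, $n=|\mathcal V|$, and $c\ge2$ is the number of labels. $\Omega\in\mathbb R^{\mathcal V\times\mathcal V}$ is of the form $\Omega(x,y)=\Theta(x,y)\alpha^2(x,y)$ for $x\ne y$, $\Omega(x,x)=\Theta(x,x)$, where, with $\mathcal V^{\alpha}_{\mathcal I}=\{x\in\mathbb Z^d\setminus\mathcal V:\alpha(x,y)\neq0\text{ for some }y\in\mathcal V\}$ and $\overline{\mathcal V}=\mathcal V\,\dot\cup\,\mathcal V^{\alpha}_{\mathcal I}$ (finite), $\alpha\colon\overline{\mathcal V}\times\overline{\mathcal V}\to\mathbb R$ is antisymmetric with $\alpha=0$ on $\mathcal V^{\alpha}_{\mathcal I}\times\mathcal V^{\alpha}_{\mathcal I}$ and $\Theta\colon\overline{\mathcal V}\times\overline{\mathcal V}\to\mathbb R$ is symmetric and nonnegative. Standing assumption on the weights: $0\le\Omega(x,y)\le1$ and $\sum_{y\in\mathcal V}\Omega(x,y)=1$ for all $x\in\mathcal V$. $\mathcal N(x)=\{y\in\mathcal V:\Omega(x,y)>0\}$.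 $\lambda_{\min}(\Omega)$ is the smallest eigenvalue of $\Omega$. $\mathcal S$ is the relative interior of the probability simplex $\Delta_c\subset\mathbb R^c$; $\mathcal W$ is the set of $n\times c$ matrices $S$ with rows $S(x)\in\mathcal S$, $x\in\mathcal V$; $\overline{\mathcal W}$ its closure. $(\Omega S)_j(x)=\sum_{y}\Omega(x,y)S_j(y)$. $\mathcal T_0$ is the space of $n\times c$ matrices with all row sums zero, $\Pi_0$ the orthogonal projection onto it. $R_p=\mathrm{Diag}(p)-pp^\top$, applied row-wise: $(R_SV)(x)=R_{S(x)}V(x)$. $S^*$ is an equilibrium if $R_{S^*}(\Omega S^* )=0$. $\exp_p(v)=\frac{p\odot e^v}{\langle p,e^v\rangle}$ (componentwise operations, $v\in\mathbb R^c$), applied row-wise. $\langle\cdot,\cdot\rangle$ is the Frobenius inner product, $\langle U,V\rangle_S=\sum_{x\in\mathcal V}\sum_{j=1}^c\frac{U_j(x)V_j(x)}{S_j(x)}$, $\|U\|_S^2=\langle U,U\rangle_S$. $J(S)=-\frac12\langle S,\Omega S\rangle$, $\mathrm{grad}_gJ(S)=-R_S(\Omega S)$. Basins of attraction: $B_\varepsilon(S^* )=\{S\in\overline{\mathcal W}:\max_{x\in\mathcal V}\|S(x)-S^*(x)\|_1<\varepsilon\}$; for $\varepsilon\le\varepsilon^*$ this set is contained in $A(S^* )\cap\overline{\mathcal W}$, where $A(S^* )=\bigcap_{x\in\mathcal V}\bigcap_{j\ne j^*(x)}\{S\in\mathbb R^{n\times c}:(\Omega S)_j(x)<(\Omega S)_{j^*(x)}(x)\}$.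 Accelerated geometric DC algorithm (Algorithm 4 of the paper, run without termination): fix $0<c_1<c_2<1$, $\gamma>|\lambda_{\min}(\Omega)|>0$, $\theta_0=1/\gamma$ and the initial point $S^0=\exp_{\mathbb 1_{\mathcal W}}(-\Omega D_{\mathcal X})\in\mathcal W$, where $D_{\mathcal X}\in\mathbb R^{n\times c}$ is a data matrix and $\mathbb 1_{\mathcal W}$ has all entries $1/c$. At step $k$ choose $$h_k\in\Big(0,\frac{\|R_{S^k}(\Omega S^k)\|_{S^k}^2}{|\langle R_{S^k}(\Omega S^k),\Omega R_{S^k}(\Omega S^k)\rangle|}\Big),\qquad d^k=\Pi_0\Omega S^k+\frac{h_k}{2}\Omega R_{S^k}(\Omega S^k),$$ and set $S^{k+1}=\exp_{S^k}(\theta_kd^k)$, where $\theta_k$ is the current step size if it satisfies the two conditions below, and otherwise is determined by a bisection line search, with values in $[\theta_0,1/|\lambda_{\min}(\Omega)|]$, so that they are satisfied: $$J(S^{k+1})-J(S^k)\le c_1\theta_k\langle\mathrm{grad}_gJ(S^k),R_{S^k}(d^k)\rangle_{S^k},\quad |\langle\mathrm{grad}_gJ(S^{k+1}),R_{S^k}(d^k)\rangle_{S^k}|\le c_2|\langle\mathrm{grad}_gJ(S^k),R_{S^k}(d^k)\rangle_{S^k}| .$$ *)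

theory Defs
  imports "HOL-Analysis.Analysis"
begin

text \<open>
  The vertex set \<open>\<V> \<subset> \<int>\<^sup>d\<close> is the range of an injection \<open>pos :: 'v \<Rightarrow> int ^ 'd\<close> of a finite
  index type, so that \<open>n \<times> c\<close> matrices are elements of \<open>real ^ 'c ^ 'v\<close>, with row \<open>S(x) = S $ x\<close>;
  \<open>\<Omega> S\<close> is \<open>\<Omega> ** S\<close>, and the Frobenius inner product is the inner product \<open>\<bullet>\<close> of this type.
\<close>

section \<open>Nonlocal weights\<close>

definition interaction_set ::
    "('v \<Rightarrow> int ^ 'd) \<Rightarrow> (int ^ 'd \<Rightarrow> int ^ 'd \<Rightarrow> real) \<Rightarrow> (int ^ 'd) set" where
  "interaction_set pos \<alpha> = {x. x \<notin> range pos \<and> (\<exists>y \<in> range pos. \<alpha> x y \<noteq> 0)}"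

definition closed_vertex_set ::
    "('v \<Rightarrow> int ^ 'd) \<Rightarrow> (int ^ 'd \<Rightarrow> int ^ 'd \<Rightarrow> real) \<Rightarrow> (int ^ 'd) set" where
  "closed_vertex_set pos \<alpha> = range pos \<union> interaction_set pos \<alpha>"

text \<open>
  The functions \<open>\<alpha>\<close> and \<open>\<Theta>\<close> are total on \<open>\<int>\<^sup>d \<times> \<int>\<^sup>d\<close>, but constrained only on
  \<open>closed_vertex_set pos \<alpha>\<close>.
\<close>

definition admissible_parameters ::
    "('v \<Rightarrow> int ^ 'd) \<Rightarrow> (int ^ 'd \<Rightarrow> int ^ 'd \<Rightarrow> real) \<Rightarrow>
     (int ^ 'd \<Rightarrow> int ^ 'd \<Rightarrow> real) \<Rightarrow> bool" where
  "admissible_parameters pos \<alpha> \<Theta> \<longleftrightarrow>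
     finite (interaction_set pos \<alpha>) \<and>
     (\<forall>x \<in> closed_vertex_set pos \<alpha>. \<forall>y \<in> closed_vertex_set pos \<alpha>.
        \<alpha> x y = - \<alpha> y x \<and> \<Theta> x y = \<Theta> y x \<and> 0 \<le> \<Theta> x y) \<and>
     (\<forall>x \<in> interaction_set pos \<alpha>. \<forall>y \<in> interaction_set pos \<alpha>. \<alpha> x y = 0)"

definition nonlocal_weights ::
    "('v::finite \<Rightarrow> int ^ 'd) \<Rightarrow> (int ^ 'd \<Rightarrow> int ^ 'd \<Rightarrow> real) \<Rightarrow>
     (int ^ 'd \<Rightarrow> int ^ 'd \<Rightarrow> real) \<Rightarrow> real ^ 'v ^ 'v" where
  "nonlocal_weights pos \<alpha> \<Theta> =
     (\<chi> x y. if x = y then \<Theta> (pos x) (pos x) else \<Theta> (pos x) (pos y) * (\<alpha> (pos x) (pos y))\<^sup>2)"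

definition neighborhood :: "real ^ 'v ^ 'v \<Rightarrow> 'v \<Rightarrow> 'v set" where
  "neighborhood \<Omega> x = {y. \<Omega> $ x $ y > 0}"

text \<open>For the matrices considered here (real symmetric) the set below is finite and nonempty.\<close>

definition lambda_min :: "real ^ 'v ^ 'v::finite \<Rightarrow> real" where
  "lambda_min A = Min {\<mu>. \<exists>v. v \<noteq> 0 \<and> A *v v = \<mu> *s v}"


section \<open>Assignment manifold\<close>

definition prob_simplex :: "(real ^ 'c::finite) set" where
  "prob_simplex = {p. (\<forall>j. 0 \<le> p $ j) \<and> (\<Sum>j\<in>UNIV. p $ j) = 1}"

definition assignment_manifold :: "(real ^ 'c::finite ^ 'v::finite) set" where
  "assignment_manifold = {S. \<forall>x. S $ x \<in> rel_interior prob_simplex}"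

definition barycenter :: "real ^ 'c::finite ^ 'v::finite" where
  "barycenter = (\<chi> x j. 1 / real CARD('c))"

definition tangent_space :: "(real ^ 'c::finite ^ 'v::finite) set" where
  "tangent_space = {U. \<forall>x. (\<Sum>j\<in>UNIV. U $ x $ j) = 0}"

definition tangent_projection :: "real ^ 'c::finite ^ 'v::finite \<Rightarrow> real ^ 'c ^ 'v" where
  "tangent_projection U =
     (THE P. P \<in> tangent_space \<and> (\<forall>Y \<in> tangent_space. (U - P) \<bullet> Y = 0))"

definition replicator_matrix :: "real ^ 'c::finite \<Rightarrow> real ^ 'c ^ 'c" where
  "replicator_matrix p = (\<chi> i j. (if i = j then p $ i else 0) - p $ i * p $ j)"

definition replicator ::
    "real ^ 'c::finite ^ 'v::finite \<Rightarrow> real ^ 'c ^ 'v \<Rightarrow> real ^ 'c ^ 'v" where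
  "replicator S U = (\<chi> x. replicator_matrix (S $ x) *v (U $ x))"

definition equilibrium :: "real ^ 'v ^ 'v \<Rightarrow> real ^ 'c::finite ^ 'v::finite \<Rightarrow> bool" where
  "equilibrium \<Omega> S \<longleftrightarrow> replicator S (\<Omega> ** S) = 0"

definition lift_exp ::
    "real ^ 'c::finite ^ 'v::finite \<Rightarrow> real ^ 'c ^ 'v \<Rightarrow> real ^ 'c ^ 'v" where
  "lift_exp S U =
     (\<chi> x j. S $ x $ j * exp (U $ x $ j) / (\<Sum>l\<in>UNIV. S $ x $ l * exp (U $ x $ l)))"

definition metric_inner ::
    "real ^ 'c::finite ^ 'v::finite \<Rightarrow> real ^ 'c ^ 'v \<Rightarrow> real ^ 'c ^ 'v \<Rightarrow> real" where
  "metric_inner S U Y = (\<Sum>x\<in>UNIV. \<Sum>j\<in>UNIV. U $ x $ j * Y $ x $ j / S $ x $ j)"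

definition potential :: "real ^ 'v ^ 'v \<Rightarrow> real ^ 'c::finite ^ 'v::finite \<Rightarrow> real" where
  "potential \<Omega> S = - (1/2) * (S \<bullet> (\<Omega> ** S))"

definition potential_grad ::
    "real ^ 'v ^ 'v \<Rightarrow> real ^ 'c::finite ^ 'v::finite \<Rightarrow> real ^ 'c ^ 'v" where
  "potential_grad \<Omega> S = - replicator S (\<Omega> ** S)"


section \<open>The accelerated geometric DC algorithm\<close>

definition search_direction ::
    "real ^ 'v ^ 'v \<Rightarrow> real ^ 'c::finite ^ 'v::finite \<Rightarrow> real \<Rightarrow> real ^ 'c ^ 'v" where
  "search_direction \<Omega> S h =
     tangent_projection (\<Omega> ** S) + (h / 2) *\<^sub>R (\<Omega> ** replicator S (\<Omega> ** S))"

text \<open>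
  If the denominator vanishes, the interval for \<open>h\<close> is read as \<open>(0, \<infinity>)\<close>; the bound
  \<open>x / 0 = 0\<close> would leave no admissible \<open>h\<close> at all.
\<close>

definition admissible_h ::
    "real ^ 'v ^ 'v \<Rightarrow> real ^ 'c::finite ^ 'v::finite \<Rightarrow> real \<Rightarrow> bool" where
  "admissible_h \<Omega> S h \<longleftrightarrow>
     (let U = replicator S (\<Omega> ** S) in
        0 < h \<and> (U \<bullet> (\<Omega> ** U) \<noteq> 0 \<longrightarrow> h < metric_inner S U U / \<bar>U \<bullet> (\<Omega> ** U)\<bar>))"

definition step_conditions ::
    "real ^ 'v ^ 'v \<Rightarrow> real \<Rightarrow> real \<Rightarrow> real ^ 'c::finite ^ 'v::finite \<Rightarrow>
     real ^ 'c ^ 'v \<Rightarrow> real \<Rightarrow> bool" where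
  "step_conditions \<Omega> c1 c2 S d \<theta> \<longleftrightarrow>
     (let S' = lift_exp S (\<theta> *\<^sub>R d);
          slope = metric_inner S (potential_grad \<Omega> S) (replicator S d) in
        potential \<Omega> S' - potential \<Omega> S \<le> c1 * \<theta> * slope \<and>
        \<bar>metric_inner S (potential_grad \<Omega> S') (replicator S d)\<bar> \<le> c2 * \<bar>slope\<bar>)"

text \<open>
  Here \<open>\<theta> k\<close> is the step size actually used in step \<open>k\<close>. The current step size at the beginning
  of step \<open>k\<close> is \<open>1/\<gamma>\<close> for \<open>k = 0\<close> and \<open>\<theta> (k - 1)\<close> otherwise. It is kept whenever it satisfies
  the conditions; otherwise the line search may return any value in the search interval that
  satisfies them.
\<close>

definition accelerated_DC_run ::
    "real ^ 'v ^ 'v \<Rightarrow> real \<Rightarrow> real \<Rightarrow> real \<Rightarrow> real ^ 'c::finite ^ 'v::finite \<Rightarrow>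
     (nat \<Rightarrow> real ^ 'c ^ 'v) \<Rightarrow> (nat \<Rightarrow> real) \<Rightarrow> (nat \<Rightarrow> real) \<Rightarrow> bool" where
  "accelerated_DC_run \<Omega> c1 c2 \<gamma> D S h \<theta> \<longleftrightarrow>
     S 0 = lift_exp barycenter (- (\<Omega> ** D)) \<and>
     (\<forall>k. let d = search_direction \<Omega> (S k) (h k);
              current = (case k of 0 \<Rightarrow> 1 / \<gamma> | Suc m \<Rightarrow> \<theta> m) in
            admissible_h \<Omega> (S k) (h k) \<and>
            (step_conditions \<Omega> c1 c2 (S k) d current \<longrightarrow> \<theta> k = current) \<and>
            \<theta> k \<in> {1 / \<gamma> .. 1 / \<bar>lambda_min \<Omega>\<bar>} \<and>
            step_conditions \<Omega> c1 c2 (S k) d (\<theta> k) \<and>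
            S (Suc k) = lift_exp (S k) (\<theta> k *\<^sub>R d))"


section \<open>Basins of attraction\<close>

definition l1_norm :: "real ^ 'c::finite \<Rightarrow> real" where
  "l1_norm v = (\<Sum>j\<in>UNIV. \<bar>v $ j\<bar>)"

definition basin ::
    "real \<Rightarrow> real ^ 'c::finite ^ 'v::finite \<Rightarrow> (real ^ 'c ^ 'v) set" where
  "basin \<epsilon> S\<^sub>0 = {S \<in> closure assignment_manifold. (MAX x. l1_norm (S $ x - S\<^sub>0 $ x)) < \<epsilon>}"

text \<open>\<open>gap \<Omega> js S x j\<close> is \<open>((\<Omega>S)\<^sub>l - (\<Omega>S)\<^sub>j)(x)\<close> with the label \<open>l = js x\<close>.\<close>

definition gap ::
    "real ^ 'v ^ 'v \<Rightarrow> ('v \<Rightarrow> 'c) \<Rightarrow> real ^ 'c::finite ^ 'v::finite \<Rightarrow> 'v \<Rightarrow> 'c \<Rightarrow> real" where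
  "gap \<Omega> js S x j = (\<Omega> ** S) $ x $ js x - (\<Omega> ** S) $ x $ j"

end

theory Submission
  imports Defs
begin

text \<open>
  Near the unit vectors \<open>S\<^sup>*(x) = e\<^sub>l\<close>, \<open>l = j\<^sup>*(x)\<close>, the distance \<open>\<parallel>S(x) - S\<^sup>*(x)\<parallel>\<^sub>1\<close> is
  \<open>2 (1 - S\<^sub>l(x))\<close> (lemma \<open>l1_norm_simplex_axis\<close>), so it suffices to show that the mass
  \<open>S\<^sub>l(x)\<close> strictly increases in every step of the algorithm. The map \<open>exp\<^sub>p(v)\<close> reweights \<open>p\<close> by
  \<open>e\<^sup>v\<close>, hence increases the mass of the label at which \<open>v\<close> is largest
  (lemma \<open>lift_exp_increases_dominant_label\<close>). Everything therefore reduces to the claim that inside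
  the basin the search direction \<open>d\<close> is largest at the label \<open>l\<close>, in every row
  (lemma \<open>search_direction_dominant_label\<close>).

  The direction has two parts. Projecting \<open>\<Omega>S\<close> only shifts each row by a constant, so the first
  part contributes the gap \<open>(\<Omega>S)\<^sub>l - (\<Omega>S)\<^sub>j\<close>. If \<open>g\<close> is its value at \<open>S\<^sup>*\<close>, then it is at least
  \<open>g - (\<epsilon>/2)(1 + g)\<close> in the basin (lemma \<open>gap_lower_bound\<close>). The second part is
  \<open>(h/2) \<Omega> R\<^sub>S(\<Omega>S)\<close>; as \<open>\<Omega>\<close> averages over rows and \<open>R\<^sub>S\<close> degenerates at the vertices of the
  simplex, it changes the difference of two labels by at most \<open>(h/2) \<epsilon>\<close>
  (lemma \<open>replicator_near_vertex\<close>). The assumed bound on \<open>\<epsilon>\<close> says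
  \<open>g - (\<epsilon>/2)(1 + g) \<ge> (\<epsilon>/2) C \<rho>\<^sup>*\<close>. Since \<open>C\<close> is at least twice the supremum of the \<open>h\<^sub>k\<close>, and
  \<open>\<rho>\<^sup>* \<ge> 1\<close> because the gap equals 1 at the labeling that is constant \<open>e\<^sub>l\<close>
  (lemma \<open>maximal_gap_ge_1\<close>), the factor \<open>C \<rho>\<^sup>*\<close> exceeds \<open>h\<close> and the first part wins.

  Each step thus decreases every row distance strictly and keeps the iterate in the basin. Since the
  rates \<open>\<xi>(x)\<close> may depend on \<open>k\<close>, the strict decrease from \<open>k\<^sub>0\<close> to \<open>k\<close> already yields them: take
  \<open>\<xi>(x)\<close> to be a \<open>(k - k\<^sub>0)\<close>-th root of a number strictly between the quotient of the distances
  and 1.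
\<close>

section \<open>Nested extrema over finite families\<close>

lemma nested_Min_le:
  fixes f :: "'v::finite \<Rightarrow> 'c::finite \<Rightarrow> real"
  assumes "j \<noteq> js x"
  shows "(MIN x. MIN j\<in>- {js x}. f x j) \<le> f x j"
proof -
  have "(MIN x. MIN j\<in>- {js x}. f x j) \<le> (MIN j\<in>- {js x}. f x j)"
    by (rule Min_le) auto
  also have "\<dots> \<le> f x j"
    using assms by (intro Min_le) auto
  finally show ?thesis .
qed

lemma complement_singleton_nonempty:
  assumes "2 \<le> CARD('c::finite)"
  shows "- {l::'c} \<noteq> {}"
proof
  assume "- {l} = {}"
  then have "(UNIV :: 'c set) = {l}" by auto
  then have "CARD('c) = 1" by (metis card_1_singleton_iff One_nat_def)
  with assms show False by simp
qed

lemma nested_Min_attained: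
  fixes f :: "'v::finite \<Rightarrow> 'c::finite \<Rightarrow> real"
  assumes "2 \<le> CARD('c)"
  obtains x j where "j \<noteq> js x" "(MIN x. MIN j\<in>- {js x}. f x j) = f x j"
proof -
  have "(MIN x. MIN j\<in>- {js x}. f x j) \<in> range (\<lambda>x. MIN j\<in>- {js x}. f x j)"
    by (rule Min_in) auto
  then obtain x where x: "(MIN x. MIN j\<in>- {js x}. f x j) = (MIN j\<in>- {js x}. f x j)"
    by (rule imageE)
  have "(MIN j\<in>- {js x}. f x j) \<in> f x ` (- {js x})"
    using complement_singleton_nonempty[OF assms] by (intro Min_in) auto
  with x that show thesis by auto
qed

lemma nested_Max_ge:
  fixes f :: "'v::finite \<Rightarrow> 'c::finite \<Rightarrow> real"
  assumes "j \<noteq> js x"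
  shows "f x j \<le> (MAX x. MAX j\<in>- {js x}. f x j)"
proof -
  have "f x j \<le> (MAX j\<in>- {js x}. f x j)"
    using assms by (intro Max_ge) auto
  also have "\<dots> \<le> (MAX x. MAX j\<in>- {js x}. f x j)"
    by (rule Max_ge) auto
  finally show ?thesis .
qed

lemma nested_Max_le:
  fixes f :: "'v::finite \<Rightarrow> 'c::finite \<Rightarrow> real"
  assumes "2 \<le> CARD('c)" and "\<And>x j. f x j \<le> b"
  shows "(MAX x. MAX j\<in>- {js x}. f x j) \<le> b"
  using complement_singleton_nonempty[OF assms(1)] assms(2) by (simp add: Max_le_iff)

section \<open>Simplex-valued matrices\<close>

lemma prob_simplex_le_1:
  assumes "p \<in> prob_simplex" shows "p $ j \<le> 1"
proof -
  have "p $ j \<le> (\<Sum>j\<in>UNIV. p $ j)"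
    using assms by (intro member_le_sum) (auto simp: prob_simplex_def)
  with assms show ?thesis by (simp add: prob_simplex_def)
qed

lemma prob_simplex_add_le_1:
  assumes "p \<in> prob_simplex" and "i \<noteq> j" shows "p $ i + p $ j \<le> 1"
proof -
  have "p $ i + p $ j = (\<Sum>k\<in>{i,j}. p $ k)" using assms(2) by simp
  also have "\<dots> \<le> (\<Sum>k\<in>UNIV. p $ k)"
    using assms(1) by (intro sum_mono2) (auto simp: prob_simplex_def)
  finally show ?thesis using assms(1) by (simp add: prob_simplex_def)
qed

lemma axis_in_prob_simplex: "axis l 1 \<in> prob_simplex"
  by (simp add: prob_simplex_def axis_def)

lemma l1_norm_simplex_axis:
  assumes "p \<in> prob_simplex"
  shows "l1_norm (p - axis l 1) = 2 * (1 - p $ l)"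
proof -
  have "l1_norm (p - axis l 1) = \<bar>p $ l - 1\<bar> + (\<Sum>j\<in>UNIV - {l}. \<bar>p $ j - axis l 1 $ j\<bar>)"
    unfolding l1_norm_def by (subst sum.remove[of _ l]) (auto simp: axis_def)
  also have "(\<Sum>j\<in>UNIV - {l}. \<bar>p $ j - axis l 1 $ j\<bar>) = (\<Sum>j\<in>UNIV - {l}. p $ j)"
    using assms by (intro sum.cong) (auto simp: axis_def prob_simplex_def)
  also have "\<dots> = 1 - p $ l"
    using assms by (simp add: prob_simplex_def sum_diff1)
  finally show ?thesis using prob_simplex_le_1[OF assms, of l] by simp
qed

lemma convex_prob_simplex: "convex prob_simplex"
  unfolding convex_def prob_simplex_def
  by (auto simp: sum.distrib simp flip: sum_distrib_left)

lemma closed_prob_simplex: "closed (prob_simplex :: (real ^ 'c::finite) set)"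
proof -
  have "closed {p :: real ^ 'c. \<forall>j. 0 \<le> p $ j}"
    by (intro closed_Collect_all closed_Collect_le continuous_intros)
  moreover have "closed {p :: real ^ 'c. (\<Sum>j\<in>UNIV. p $ j) = 1}"
    by (intro closed_Collect_eq continuous_intros)
  ultimately show ?thesis
    unfolding prob_simplex_def by (simp add: Collect_conj_eq closed_Int)
qed

lemma closure_assignment_manifold_rows:
  assumes "S \<in> closure assignment_manifold"
  shows "S $ x \<in> prob_simplex"
proof -
  have "closed {S :: real ^ 'a ^ 'b. S $ x \<in> prob_simplex}"
    using closed_prob_simplex
    by (intro closed_vimage[of prob_simplex "\<lambda>S. S $ x", unfolded vimage_def] continuous_intros)
  moreover have "assignment_manifold \<subseteq> {S :: real ^ 'a ^ 'b. S $ x \<in> prob_simplex}"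
    using rel_interior_subset by (auto simp: assignment_manifold_def)
  ultimately show ?thesis
    using closure_minimal assms by blast
qed

text \<open>
  The relative interior is nonempty, and the segment from one of its points to the simplex vertex
  stays in it up to the vertex itself.
\<close>

lemma constant_labeling_in_closure:
  "(\<chi> x. (axis l 1 :: real ^ 'c::finite)) \<in> closure (assignment_manifold :: (real ^ 'c ^ 'v::finite) set)"
proof -
  let ?e = "axis l 1 :: real ^ 'c"
  have "rel_interior (prob_simplex :: (real ^ 'c) set) \<noteq> {}"
    using rel_interior_eq_empty[OF convex_prob_simplex] axis_in_prob_simplex by blast
  then obtain a where a: "a \<in> rel_interior (prob_simplex :: (real ^ 'c) set)" by blast
  define p where "p n = ?e - inverse (real (Suc n)) *\<^sub>R (?e - a)" for n
  have p_in: "p n \<in> rel_interior prob_simplex" for n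
    unfolding p_def
    using axis_in_prob_simplex
    by (intro rel_interior_convex_shrink[OF convex_prob_simplex a]) (auto simp: field_simps)
  have "p \<longlonglongrightarrow> ?e - 0 *\<^sub>R (?e - a)"
    unfolding p_def by (intro tendsto_intros LIMSEQ_inverse_real_of_nat)
  then have "(\<lambda>n. (\<chi> x. p n) :: real ^ 'c ^ 'v) \<longlonglongrightarrow> (\<chi> x. ?e)"
    by - (rule vec_tendstoI, simp)
  moreover have "((\<chi> x. p n) :: real ^ 'c ^ 'v) \<in> assignment_manifold" for n
    using p_in by (simp add: assignment_manifold_def)
  ultimately show ?thesis
    unfolding closure_sequential
    by (intro exI[of _ "\<lambda>n. (\<chi> x. p n)"]) simp
qed

section \<open>The exponential map\<close>

lemma lift_exp_rows:
  assumes "\<And>j. 0 < S $ x $ j"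
  shows "0 < lift_exp S U $ x $ j" and "lift_exp S U $ x \<in> prob_simplex"
proof -
  have Z: "0 < (\<Sum>l\<in>UNIV. S $ x $ l * exp (U $ x $ l))"
    using assms by (intro sum_pos) auto
  then show pos: "0 < lift_exp S U $ x $ j" for j
    using assms by (simp add: lift_exp_def)
  have "(\<Sum>j\<in>UNIV. lift_exp S U $ x $ j) = 1"
    using Z by (simp add: lift_exp_def flip: sum_divide_distrib)
  with pos show "lift_exp S U $ x \<in> prob_simplex"
    by (auto simp: prob_simplex_def less_imp_le)
qed

text \<open>
  The normalizing constant is an average of the weights \<open>e\<^bsup>U\<^sub>j\<^esup>\<close>, hence smaller than the largest
  weight; strictness needs a second label of positive mass.
\<close>

lemma lift_exp_increases_dominant_label:
  fixes S U :: "real ^ 'c::finite ^ 'v::finite"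
  assumes labels: "2 \<le> CARD('c)"
    and pos: "\<And>j. 0 < S $ x $ j" and simplex: "S $ x \<in> prob_simplex"
    and dominant: "\<And>j. j \<noteq> l \<Longrightarrow> U $ x $ j < U $ x $ l"
  shows "S $ x $ l < lift_exp S U $ x $ l"
proof -
  let ?Z = "\<Sum>j\<in>UNIV. S $ x $ j * exp (U $ x $ j)"
  have Z: "0 < ?Z"
    using pos by (intro sum_pos) auto
  obtain i where "i \<noteq> l"
    using complement_singleton_nonempty[OF labels, of l] by auto
  then have "?Z < (\<Sum>j\<in>UNIV. S $ x $ j * exp (U $ x $ l))"
  proof (intro sum_strict_mono_ex1 ballI bexI[of _ i])
    fix j
    have "U $ x $ j \<le> U $ x $ l" using dominant[of j] by (cases "j = l") auto
    then show "S $ x $ j * exp (U $ x $ j) \<le> S $ x $ j * exp (U $ x $ l)"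
      using pos[of j] by simp
  qed (use pos dominant in auto)
  also have "\<dots> = exp (U $ x $ l)"
    using simplex by (simp add: prob_simplex_def flip: sum_distrib_right)
  finally have "S $ x $ l * ?Z < S $ x $ l * exp (U $ x $ l)"
    using pos by simp
  with Z show ?thesis
    by (simp add: lift_exp_def pos_less_divide_eq)
qed

section \<open>The two parts of the search direction\<close>

lemma tangent_projection_eq:
  fixes U :: "real ^ 'c::finite ^ 'v::finite"
  shows "tangent_projection U = (\<chi> x j. U $ x $ j - (\<Sum>i\<in>UNIV. U $ x $ i) / real CARD('c))"
    (is "_ = ?P")
  unfolding tangent_projection_def
proof (rule the_equality, intro conjI ballI)
  show P: "?P \<in> tangent_space"
    by (simp add: tangent_space_def sum_subtractf)
  show orth: "(U - ?P) \<bullet> Y = 0" if "Y \<in> tangent_space" for Y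
    using that by (simp add: inner_vec_def tangent_space_def flip: sum_distrib_left sum_divide_distrib)
  fix Q
  assume Q: "Q \<in> tangent_space \<and> (\<forall>Y\<in>tangent_space. (U - Q) \<bullet> Y = 0)"
  have "Q - ?P \<in> tangent_space"
    using P Q by (simp add: tangent_space_def sum_subtractf)
  then have "(U - ?P) \<bullet> (Q - ?P) - (U - Q) \<bullet> (Q - ?P) = 0"
    using Q orth by simp
  then have "(Q - ?P) \<bullet> (Q - ?P) = 0"
    by (simp flip: inner_diff_left)
  then show "Q = ?P" by simp
qed

lemma search_direction_diff:
  "search_direction \<Omega> S h $ x $ i - search_direction \<Omega> S h $ x $ j =
     ((\<Omega> ** S) $ x $ i - (\<Omega> ** S) $ x $ j)
     + h / 2 * (\<Sum>y\<in>UNIV. \<Omega> $ x $ y *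
         (replicator S (\<Omega> ** S) $ y $ i - replicator S (\<Omega> ** S) $ y $ j))"
proof -
  have "(\<Omega> ** replicator S (\<Omega> ** S)) $ x $ i - (\<Omega> ** replicator S (\<Omega> ** S)) $ x $ j =
     (\<Sum>y\<in>UNIV. \<Omega> $ x $ y * (replicator S (\<Omega> ** S) $ y $ i - replicator S (\<Omega> ** S) $ y $ j))"
    by (simp add: matrix_matrix_mult_def[of \<Omega> "replicator _ _"] right_diff_distrib sum_subtractf)
  then show ?thesis
    unfolding search_direction_def tangent_projection_eq
    by (simp add: algebra_simps flip: distrib_left)
qed

lemma replicator_component:
  "replicator S F $ x $ i = S $ x $ i * (F $ x $ i - (\<Sum>j\<in>UNIV. S $ x $ j * F $ x $ j))"
proof -
  have "replicator S F $ x $ i =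
      (\<Sum>j\<in>UNIV. (if j = i then S $ x $ i * F $ x $ i else 0) - S $ x $ i * (S $ x $ j * F $ x $ j))"
    by (auto simp: replicator_def replicator_matrix_def matrix_vector_mult_def algebra_simps
        intro!: sum.cong)
  also have "\<dots> = S $ x $ i * (F $ x $ i - (\<Sum>j\<in>UNIV. S $ x $ j * F $ x $ j))"
    by (simp add: sum_subtractf right_diff_distrib flip: sum_distrib_left)
  finally show ?thesis .
qed

text \<open>
  The factor \<open>F\<^sub>i - \<langle>p, F\<rangle>\<close> only sees the mass outside \<open>i\<close>, so the component is at most
  \<open>p\<^sub>i (1 - p\<^sub>i)\<close> in modulus; one of these two factors is small near the vertex \<open>e\<^sub>m\<close>, for
  \<open>i = m\<close> as well as for \<open>i \<noteq> m\<close>.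
\<close>

lemma replicator_near_vertex:
  assumes p: "S $ x \<in> prob_simplex" and F: "\<And>j. 0 \<le> F $ x $ j" "\<And>j. F $ x $ j \<le> 1"
  shows "\<bar>replicator S F $ x $ i\<bar> \<le> 1 - S $ x $ m"
proof -
  let ?p = "S $ x" and ?f = "F $ x"
  have p0: "0 \<le> ?p $ j" for j using p by (simp add: prob_simplex_def)
  have split: "(\<Sum>j\<in>UNIV. ?p $ j * ?f $ j) = ?p $ i * ?f $ i + (\<Sum>j\<in>UNIV - {i}. ?p $ j * ?f $ j)"
    by (simp add: sum.remove)
  have low: "0 \<le> (\<Sum>j\<in>UNIV - {i}. ?p $ j * ?f $ j)"
    using p0 F by (intro sum_nonneg) auto
  have "(\<Sum>j\<in>UNIV - {i}. ?p $ j * ?f $ j) \<le> (\<Sum>j\<in>UNIV - {i}. ?p $ j)"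
    using p0 F by (intro sum_mono) (simp add: mult_left_le)
  also have "\<dots> = 1 - ?p $ i"
    using p by (simp add: prob_simplex_def sum_diff1)
  finally have up: "(\<Sum>j\<in>UNIV - {i}. ?p $ j * ?f $ j) \<le> 1 - ?p $ i" .
  have i1: "0 \<le> 1 - ?p $ i" using prob_simplex_le_1[OF p, of i] by simp
  have "(1 - ?p $ i) * ?f $ i \<le> 1 - ?p $ i" "0 \<le> (1 - ?p $ i) * ?f $ i"
    using i1 F by (simp_all add: mult_left_le)
  then have "\<bar>?f $ i - (\<Sum>j\<in>UNIV. ?p $ j * ?f $ j)\<bar> \<le> 1 - ?p $ i"
    using low up unfolding split by (simp add: abs_le_iff algebra_simps)
  then have bound: "\<bar>replicator S F $ x $ i\<bar> \<le> ?p $ i * (1 - ?p $ i)"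
    using p0 by (simp add: replicator_component abs_mult mult_left_mono)
  show ?thesis
  proof (cases "i = m")
    case True
    have "?p $ i * (1 - ?p $ i) \<le> 1 - ?p $ i"
      using i1 prob_simplex_le_1[OF p, of i] by (simp add: mult_left_le_one_le p0)
    with bound True show ?thesis by simp
  next
    case False
    have "?p $ i * (1 - ?p $ i) \<le> ?p $ i"
      using p0[of i] by (simp add: mult_left_le)
    with bound prob_simplex_add_le_1[OF p False] show ?thesis by simp
  qed
qed

lemma stochastic_mult_bounds:
  fixes \<Omega> :: "real ^ 'v::finite ^ 'v" and S :: "real ^ 'c::finite ^ 'v"
  assumes "\<And>y. 0 \<le> \<Omega> $ x $ y" and "(\<Sum>y\<in>UNIV. \<Omega> $ x $ y) = 1"
    and "\<And>y. S $ y \<in> prob_simplex"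
  shows "0 \<le> (\<Omega> ** S) $ x $ j" and "(\<Omega> ** S) $ x $ j \<le> 1"
proof -
  show "0 \<le> (\<Omega> ** S) $ x $ j"
    using assms by (auto simp: matrix_matrix_mult_def prob_simplex_def intro!: sum_nonneg)
  have "(\<Sum>y\<in>UNIV. \<Omega> $ x $ y * S $ y $ j) \<le> (\<Sum>y\<in>UNIV. \<Omega> $ x $ y)"
    using assms(1) prob_simplex_le_1[OF assms(3)] by (intro sum_mono mult_left_le)
  then show "(\<Omega> ** S) $ x $ j \<le> 1"
    using assms by (simp add: matrix_matrix_mult_def)
qed

text \<open>
  Neighbours \<open>y\<close> with label \<open>l = j\<^sup>*(x)\<close> lose at most \<open>\<epsilon>\<close> of \<open>S\<^sub>l(y) - S\<^sub>j(y)\<close>, those with label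
  \<open>j\<close> lose nothing, as the value \<open>-1\<close> at \<open>S\<^sub>0\<close> is minimal, and all others lose at most
  \<open>\<epsilon>/2\<close>. In each case this bound is \<open>(\<epsilon>/2)(1 + t)\<close>, where \<open>t\<close> is the value at \<open>S\<^sub>0\<close>;
  averaging over \<open>y\<close> gives the bound. This case distinction is what produces \<open>1 + g\<close> in the
  denominator of the admissible radius, instead of the cruder 2.
\<close>

lemma gap_lower_bound:
  fixes \<Omega> :: "real ^ 'v::finite ^ 'v" and S S\<^sub>0 :: "real ^ 'c::finite ^ 'v"
  assumes nonneg: "\<And>y. 0 \<le> \<Omega> $ x $ y" and row: "(\<Sum>y\<in>UNIV. \<Omega> $ x $ y) = 1"
    and S: "\<And>y. S $ y \<in> prob_simplex" and S\<^sub>0: "\<And>y. S\<^sub>0 $ y = axis (js y) 1"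
    and near: "\<And>y. 2 * (1 - S $ y $ js y) < \<epsilon>" and j: "j \<noteq> js x"
  shows "gap \<Omega> js S\<^sub>0 x j - \<epsilon> / 2 * (1 + gap \<Omega> js S\<^sub>0 x j) \<le> gap \<Omega> js S x j"
proof -
  let ?t = "\<lambda>y. S\<^sub>0 $ y $ js x - S\<^sub>0 $ y $ j"
  have gap: "gap \<Omega> js T x j = (\<Sum>y\<in>UNIV. \<Omega> $ x $ y * (T $ y $ js x - T $ y $ j))"
    for T :: "real ^ 'c ^ 'v"
    by (simp add: gap_def matrix_matrix_mult_def right_diff_distrib sum_subtractf)
  have pointwise: "?t y - \<epsilon> / 2 * (1 + ?t y) \<le> S $ y $ js x - S $ y $ j" for y
  proof -
    have S01: "0 \<le> S $ y $ i" "S $ y $ i \<le> 1" for i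
      using S[of y] prob_simplex_le_1 by (auto simp: prob_simplex_def)
    consider "js y = js x" | "js y = j" | "js y \<noteq> js x" "js y \<noteq> j" by blast
    then show ?thesis
    proof cases
      case 1
      then show ?thesis
        using prob_simplex_add_le_1[OF S j, of y] near[of y] j by (simp add: S\<^sub>0 axis_def)
    next
      case 2
      then show ?thesis
        using S01[of j] S01[of "js x"] j by (simp add: S\<^sub>0 axis_def)
    next
      case 3
      then have "?t y = 0" by (simp add: S\<^sub>0 axis_def)
      then show ?thesis
        using prob_simplex_add_le_1[OF S 3(2), of y] near[of y] S01[of "js x"] by simp
    qed
  qed
  have "gap \<Omega> js S\<^sub>0 x j - \<epsilon> / 2 * (1 + gap \<Omega> js S\<^sub>0 x j) =
      gap \<Omega> js S\<^sub>0 x j - \<epsilon> / 2 * ((\<Sum>y\<in>UNIV. \<Omega> $ x $ y) + gap \<Omega> js S\<^sub>0 x j)"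
    using row by simp
  also have "\<dots> = (\<Sum>y\<in>UNIV. \<Omega> $ x $ y * (?t y - \<epsilon> / 2 * (1 + ?t y)))"
    unfolding gap sum.distrib[symmetric] sum_distrib_left sum_subtractf[symmetric]
    by (intro sum.cong) (auto simp: algebra_simps)
  also have "\<dots> \<le> gap \<Omega> js S x j"
    unfolding gap by (intro sum_mono mult_left_mono pointwise nonneg)
  finally show ?thesis .
qed

text \<open>
  The condition on \<open>\<epsilon>\<close> makes the gap part at least \<open>(\<epsilon>/2) K\<close>, while the replicator part is at most
  \<open>(\<epsilon>/2) h\<close> in modulus. The number \<open>K\<close> stands for \<open>C \<rho>\<^sup>*\<close>.
\<close>

lemma search_direction_dominant_label:
  fixes \<Omega> :: "real ^ 'v::finite ^ 'v" and S S\<^sub>0 :: "real ^ 'c::finite ^ 'v"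
  assumes nonneg: "\<And>x y. 0 \<le> \<Omega> $ x $ y" and row: "\<And>x. (\<Sum>y\<in>UNIV. \<Omega> $ x $ y) = 1"
    and S: "\<And>y. S $ y \<in> prob_simplex" and S\<^sub>0: "\<And>y. S\<^sub>0 $ y = axis (js y) 1"
    and near: "\<And>y. 2 * (1 - S $ y $ js y) < \<epsilon>" and j: "j \<noteq> js x"
    and h: "0 \<le> h" "h < K"
    and \<epsilon>: "0 < \<epsilon>" "\<epsilon> * (1 + K + gap \<Omega> js S\<^sub>0 x j) \<le> 2 * gap \<Omega> js S\<^sub>0 x j"
  shows "search_direction \<Omega> S h $ x $ j < search_direction \<Omega> S h $ x $ js x"
proof -
  let ?R = "replicator S (\<Omega> ** S)"
  let ?r = "\<Sum>y\<in>UNIV. \<Omega> $ x $ y * (?R $ y $ js x - ?R $ y $ j)"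
  have R: "\<bar>?R $ y $ i\<bar> \<le> \<epsilon> / 2" for y i
    using replicator_near_vertex[OF S stochastic_mult_bounds[OF nonneg row S],
        where i = i and m = "js y"] near[of y] by (smt (verit) field_sum_of_halves)
  have "- \<epsilon> = (\<Sum>y\<in>UNIV. \<Omega> $ x $ y * - \<epsilon>)"
    using row by (simp add: sum_negf flip: sum_distrib_right)
  also have "\<dots> \<le> ?r"
  proof (intro sum_mono mult_left_mono nonneg)
    show "- \<epsilon> \<le> ?R $ y $ js x - ?R $ y $ j" for y
      using R[of y "js x"] R[of y j] by linarith
  qed
  finally have "h / 2 * (- \<epsilon>) \<le> h / 2 * ?r"
    using h by (intro mult_left_mono) auto
  moreover have "\<epsilon> / 2 * h < \<epsilon> / 2 * K"
    using h \<epsilon> by simp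
  moreover have "gap \<Omega> js S\<^sub>0 x j - \<epsilon> / 2 * (1 + gap \<Omega> js S\<^sub>0 x j) \<le> gap \<Omega> js S x j"
    by (rule gap_lower_bound[where S\<^sub>0 = S\<^sub>0]) (use assms in auto)
  ultimately have "0 < gap \<Omega> js S x j + h / 2 * ?r"
    using \<epsilon>(2) by (simp add: algebra_simps)
  then show ?thesis
    using search_direction_diff[of \<Omega> S h x "js x" j] by (simp add: gap_def)
qed

section \<open>Stable equilibria and constants\<close>

text \<open>
  At an equilibrium, every label of positive mass has the same value of \<open>\<Omega>S\<^sup>*\<close>, namely the
  average. The label \<open>l\<close> of largest mass is one of them, and all others have a smaller value.
\<close>

lemma stable_equilibrium_is_vertex:
  fixes S :: "real ^ 'c::finite ^ 'v::finite"
  assumes S: "S $ x \<in> prob_simplex" and eq: "equilibrium \<Omega> S"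
    and l: "is_arg_max (\<lambda>l. S $ x $ l) (\<lambda>l. True) l"
    and stable: "\<And>j. j \<noteq> l \<Longrightarrow> (\<Omega> ** S) $ x $ j < (\<Omega> ** S) $ x $ l"
  shows "S $ x = axis l 1"
proof -
  let ?avg = "\<Sum>j\<in>UNIV. S $ x $ j * (\<Omega> ** S) $ x $ j"
  have zero: "S $ x $ i * ((\<Omega> ** S) $ x $ i - ?avg) = 0" for i
    using eq replicator_component[of S "\<Omega> ** S" x i] by (simp add: equilibrium_def)
  have "S $ x $ l \<noteq> 0"
  proof
    assume "S $ x $ l = 0"
    with l have "S $ x $ i \<le> 0" for i by (auto simp: is_arg_max_linorder)
    then have "(\<Sum>i\<in>UNIV. S $ x $ i) \<le> 0" by (intro sum_nonpos)
    with S show False by (simp add: prob_simplex_def)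
  qed
  then have avg: "(\<Omega> ** S) $ x $ l = ?avg" using zero[of l] by simp
  have others: "S $ x $ j = 0" if "j \<noteq> l" for j
    using zero[of j] stable[OF that] avg by auto
  have "(\<Sum>j\<in>UNIV. S $ x $ j) = S $ x $ l"
    using others by (subst sum.remove[of _ l]) auto
  with S others show ?thesis
    by (auto simp: vec_eq_iff axis_def prob_simplex_def)
qed

lemma gap_le_1:
  fixes \<Omega> :: "real ^ 'v::finite ^ 'v" and S :: "real ^ 'c::finite ^ 'v"
  assumes "\<And>x y. 0 \<le> \<Omega> $ x $ y" and "\<And>x. (\<Sum>y\<in>UNIV. \<Omega> $ x $ y) = 1"
    and "\<And>y. S $ y \<in> prob_simplex"
  shows "gap \<Omega> js S x j \<le> 1"
  using stochastic_mult_bounds(1)[OF assms, of x j]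
    stochastic_mult_bounds(2)[OF assms, of x "js x"] by (simp add: gap_def)

text \<open>
  The labeling that is constant \<open>e\<^sub>l\<close> with \<open>l = j\<^sup>*(x)\<close>, for one fixed \<open>x\<close>, has gap 1 at \<open>x\<close>. As the
  gap never exceeds 1, the supremum is a genuine one.
\<close>

lemma maximal_gap_ge_1:
  fixes \<Omega> :: "real ^ 'v::finite ^ 'v" and js :: "'v \<Rightarrow> 'c::finite"
  assumes labels: "2 \<le> CARD('c)"
    and nonneg: "\<And>x y. 0 \<le> \<Omega> $ x $ y" and row: "\<And>x. (\<Sum>y\<in>UNIV. \<Omega> $ x $ y) = 1"
  shows "1 \<le> (SUP S'\<in>closure assignment_manifold. MAX x. MAX j\<in>- {js x}. gap \<Omega> js S' x j)"
proof -
  fix x :: 'v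
  let ?E = "(\<chi> y. axis (js x) 1) :: real ^ 'c ^ 'v"
  obtain j where j: "j \<noteq> js x"
    using complement_singleton_nonempty[OF labels, of "js x"] by auto
  have "1 = gap \<Omega> js ?E x j"
    using j row by (simp add: gap_def matrix_matrix_mult_def axis_def)
  also have "\<dots> \<le> (MAX x. MAX j\<in>- {js x}. gap \<Omega> js ?E x j)"
    using j by (rule nested_Max_ge)
  also have "\<dots> \<le> (SUP S'\<in>closure assignment_manifold. MAX x. MAX j\<in>- {js x}. gap \<Omega> js S' x j)"
  proof (rule cSUP_upper[OF constant_labeling_in_closure])
    show "bdd_above ((\<lambda>S'. MAX x. MAX j\<in>- {js x}. gap \<Omega> js S' x j) ` closure assignment_manifold)"
      by (intro bdd_aboveI2[of _ _ 1] nested_Max_le labels gap_le_1 nonneg row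
          closure_assignment_manifold_rows)
  qed
  finally show ?thesis .
qed

lemma sum_neighborhood:
  assumes "\<And>y. 0 \<le> \<Omega> $ x $ y"
  shows "(\<Sum>y\<in>neighborhood \<Omega> x. \<Omega> $ x $ y) = (\<Sum>y\<in>UNIV. \<Omega> $ x $ (y::'v::finite))"
  using assms by (intro sum.mono_neutral_left) (auto simp: neighborhood_def order.order_iff_strict)

section \<open>Decrease of the distances along a run\<close>

text \<open>
  With a rate that may depend on the exponent, any strict decrease is a geometric one.
\<close>

lemma strict_decrease_geometric:
  fixes a b :: real
  assumes "0 \<le> a" "a < b" "0 < n"
  shows "\<exists>\<xi>. 0 < \<xi> \<and> \<xi> < 1 \<and> a < \<xi> ^ n * b"
proof -
  obtain r where r: "a / b < r" "r < 1"
    using dense[of "a / b" 1] assms by auto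
  have "0 < r" using r assms by (smt (verit) divide_nonneg_pos)
  have "0 < root n r" "root n r < 1" "root n r ^ n = r"
    using \<open>0 < r\<close> r assms by (auto simp: real_root_lt_1_iff)
  moreover have "a < r * b"
    using r assms by (simp add: pos_divide_less_eq)
  ultimately show ?thesis by metis
qed

lemma DC_run_rows:
  assumes "accelerated_DC_run \<Omega> c1 c2 \<gamma> D S h \<theta>"
  shows "0 < S k $ x $ j" and "S k $ x \<in> prob_simplex"
proof -
  have S0: "S 0 = lift_exp barycenter (- (\<Omega> ** D))"
    and step: "\<And>k. S (Suc k) = lift_exp (S k) (\<theta> k *\<^sub>R search_direction \<Omega> (S k) (h k))"
    using assms by (auto simp: accelerated_DC_run_def Let_def)
  have "(\<forall>x j. 0 < S k $ x $ j) \<and> (\<forall>x. S k $ x \<in> prob_simplex)"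
  proof (induction k)
    case 0
    show ?case unfolding S0 by (auto intro!: lift_exp_rows simp: barycenter_def)
  next
    case (Suc k)
    then show ?case unfolding step by (auto intro!: lift_exp_rows)
  qed
  then show "0 < S k $ x $ j" "S k $ x \<in> prob_simplex" by auto
qed

text \<open>
  Strict growth of the dominant mass also propagates the basin condition, so the two are proved by
  one induction on \<open>k\<close>.
\<close>

lemma DC_run_dominant_mass_increases:
  fixes \<Omega> :: "real ^ 'v::finite ^ 'v" and S :: "nat \<Rightarrow> real ^ 'c::finite ^ 'v"
  assumes run: "accelerated_DC_run \<Omega> c1 c2 \<gamma> D S h \<theta>"
    and labels: "2 \<le> CARD('c)" and \<gamma>: "0 < \<gamma>"
    and nonneg: "\<And>x y. 0 \<le> \<Omega> $ x $ y" and row: "\<And>x. (\<Sum>y\<in>UNIV. \<Omega> $ x $ y) = 1"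
    and S\<^sub>0: "\<And>y. S\<^sub>0 $ y = axis (js y) 1"
    and K: "\<And>k. h k < K"
    and \<epsilon>: "0 < \<epsilon>"
      "\<And>x j. j \<noteq> js x \<Longrightarrow> \<epsilon> * (1 + K + gap \<Omega> js S\<^sub>0 x j) \<le> 2 * gap \<Omega> js S\<^sub>0 x j"
    and near: "\<And>y. 2 * (1 - S k\<^sub>0 $ y $ js y) < \<epsilon>"
    and k: "k\<^sub>0 < k"
  shows "S k\<^sub>0 $ x $ js x < S k $ x $ js x"
proof -
  have h: "0 < h k" and \<theta>: "1 / \<gamma> \<le> \<theta> k"
    and step: "S (Suc k) = lift_exp (S k) (\<theta> k *\<^sub>R search_direction \<Omega> (S k) (h k))" for k
    using run by (auto simp: accelerated_DC_run_def admissible_h_def Let_def)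
  have \<theta>0: "0 < \<theta> k" for k
    using \<theta>[of k] \<gamma> by (smt (verit) zero_less_divide_1_iff)
  have increase: "S k $ x $ js x < S (Suc k) $ x $ js x"
    if "\<And>y. 2 * (1 - S k $ y $ js y) < \<epsilon>" for k x
    unfolding step
  proof (rule lift_exp_increases_dominant_label[OF labels DC_run_rows(1)[OF run] DC_run_rows(2)[OF run]])
    fix j
    assume "j \<noteq> js x"
    then have "search_direction \<Omega> (S k) (h k) $ x $ j < search_direction \<Omega> (S k) (h k) $ x $ js x"
      using DC_run_rows(2)[OF run] that h K \<epsilon> nonneg row S\<^sub>0
      by (intro search_direction_dominant_label[where S\<^sub>0 = S\<^sub>0 and K = K and \<epsilon> = \<epsilon>])
         (auto intro: less_imp_le)
    with \<theta>0 show "(\<theta> k *\<^sub>R search_direction \<Omega> (S k) (h k)) $ x $ j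
        < (\<theta> k *\<^sub>R search_direction \<Omega> (S k) (h k)) $ x $ js x"
      by simp
  qed
  have "\<forall>x. S k\<^sub>0 $ x $ js x < S k $ x $ js x"
    using Suc_leI[OF k]
  proof (induction k rule: dec_induct)
    case base
    then show ?case using increase near by blast
  next
    case (step k)
    have "2 * (1 - S k $ y $ js y) < \<epsilon>" for y
      using step.IH near[of y] by (smt (verit))
    then show ?case using increase step.IH by (meson less_trans)
  qed
  then show ?thesis by blast
qed

theorem theorem6p6:
  fixes pos :: "'v::finite \<Rightarrow> int ^ 'd::finite"
    and \<alpha> \<Theta> :: "int ^ 'd \<Rightarrow> int ^ 'd \<Rightarrow> real"
    and \<Omega> :: "real ^ 'v ^ 'v"
    and c1 c2 \<gamma> :: real
    and D :: "real ^ 'c::finite ^ 'v"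
    and S :: "nat \<Rightarrow> real ^ 'c ^ 'v"
    and h \<theta> :: "nat \<Rightarrow> real"
    and Sstar :: "real ^ 'c ^ 'v"
    and js :: "'v \<Rightarrow> 'c"
    and eps_star hbar rho_star C :: real
    and N :: nat
  assumes dim: "2 \<le> CARD('d)"
    and labels: "2 \<le> CARD('c)"
    and vertices: "inj pos"
    and params: "admissible_parameters pos \<alpha> \<Theta>"
    and Omega: "\<Omega> = nonlocal_weights pos \<alpha> \<Theta>"
    and Omega_range: "\<And>x y. 0 \<le> \<Omega> $ x $ y \<and> \<Omega> $ x $ y \<le> 1"
    and Omega_rows: "\<And>x. (\<Sum>y\<in>UNIV. \<Omega> $ x $ y) = 1"
    and c1c2: "0 < c1" "c1 < c2" "c2 < 1"
    and gamma: "\<bar>lambda_min \<Omega>\<bar> < \<gamma>" "0 < \<bar>lambda_min \<Omega>\<bar>"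
    and run: "accelerated_DC_run \<Omega> c1 c2 \<gamma> D S h \<theta>"
    and Sstar: "Sstar \<in> closure assignment_manifold"
    and limit_point: "\<exists>r. strict_mono r \<and> (\<lambda>i. S (r i)) \<longlonglongrightarrow> Sstar"
    and equilibrium: "equilibrium \<Omega> Sstar"
    and js: "\<And>x. is_arg_max (\<lambda>l. Sstar $ x $ l) (\<lambda>l. True) (js x)"
    and stable: "\<And>x j. j \<noteq> js x \<Longrightarrow> (\<Omega> ** Sstar) $ x $ j - (\<Omega> ** Sstar) $ x $ js x < 0"
    and eps_star: "eps_star = (MIN x. MIN j\<in>- {js x}.
          2 * gap \<Omega> js Sstar x j /
          ((\<Sum>y\<in>neighborhood \<Omega> x. \<Omega> $ x $ y) + gap \<Omega> js Sstar x j))"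
    and h_bounded: "bdd_above (range h)"
    and hbar: "hbar = (SUP k. h k)"
    and rho_star: "rho_star =
          (SUP S'\<in>closure assignment_manifold. MAX x. MAX j\<in>- {js x}. gap \<Omega> js S' x j)"
    and N: "N = (MAX y. card (neighborhood \<Omega> y))"
    and C: "C = hbar * real CARD('c) * real N"
  shows "(\<forall>x. Sstar $ x = axis (js x) 1) \<and>
    0 < eps_star \<and> 0 < hbar \<and> 0 < rho_star \<and> 0 < N \<and>
    (\<forall>\<epsilon>>0. \<epsilon> \<le> (MIN x. MIN j\<in>- {js x}.
          2 * gap \<Omega> js Sstar x j / (1 + C * rho_star + gap \<Omega> js Sstar x j)) \<longrightarrow>
       basin \<epsilon> Sstar \<subseteq> basin eps_star Sstar \<and>
       (\<forall>k\<^sub>0. S k\<^sub>0 \<in> basin \<epsilon> Sstar \<longrightarrow>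
          (\<forall>k>k\<^sub>0. \<exists>\<xi> :: 'v \<Rightarrow> real.
             (\<forall>x. 0 < \<xi> x \<and> \<xi> x < 1) \<and>
             (\<forall>x. l1_norm (S k $ x - Sstar $ x)
                    < \<xi> x ^ (k - k\<^sub>0) * l1_norm (S k\<^sub>0 $ x - Sstar $ x)))))"
proof -
  have nonneg: "\<And>x y. 0 \<le> \<Omega> $ x $ y" using Omega_range by blast
  have h_pos: "0 < h k" for k
    using run by (auto simp: accelerated_DC_run_def admissible_h_def Let_def)
  have h_le: "h k \<le> hbar" for k
    unfolding hbar using h_bounded by (rule cSUP_upper2) auto
  have vertex: "Sstar $ x = axis (js x) 1" for x
    using closure_assignment_manifold_rows[OF Sstar] equilibrium js stable
    by (intro stable_equilibrium_is_vertex[where \<Omega> = \<Omega>]) auto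
  have gap_pos: "0 < gap \<Omega> js Sstar x j" if "j \<noteq> js x" for x j
    using stable[OF that] by (simp add: gap_def)
  have neighbors: "(\<Sum>y\<in>neighborhood \<Omega> x. \<Omega> $ x $ y) = 1" for x
    using sum_neighborhood nonneg Omega_rows by metis
  have eps_star_eq: "eps_star =
      (MIN x. MIN j\<in>- {js x}. 2 * gap \<Omega> js Sstar x j / (1 + gap \<Omega> js Sstar x j))"
    unfolding eps_star neighbors ..
  have eps_star_pos: "0 < eps_star"
  proof -
    obtain x j where "j \<noteq> js x" "eps_star = 2 * gap \<Omega> js Sstar x j / (1 + gap \<Omega> js Sstar x j)"
      unfolding eps_star_eq by (rule nested_Min_attained[OF labels])
    with gap_pos show ?thesis by (simp add: add_pos_pos)
  qed
  have hbar_pos: "0 < hbar" using h_pos h_le less_le_trans by blast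
  have rho: "1 \<le> rho_star"
    unfolding rho_star by (rule maximal_gap_ge_1[OF labels nonneg Omega_rows])
  have N_pos: "0 < N"
  proof -
    fix x
    have "neighborhood \<Omega> x \<noteq> {}" using neighbors[of x] by auto
    then have "0 < card (neighborhood \<Omega> x)" by (simp add: card_gt_0_iff)
    also have "\<dots> \<le> N" unfolding N by (rule Max_ge) auto
    finally show ?thesis .
  qed
  have K: "hbar < C * rho_star"
  proof -
    have "hbar < hbar * 2" using hbar_pos by simp
    also have "\<dots> \<le> hbar * (real CARD('c) * (real N * rho_star))"
    proof (intro mult_left_mono)
      have "1 * 1 \<le> real N * rho_star"
        using N_pos rho by (intro mult_mono) auto
      then have "2 * 1 \<le> real CARD('c) * (real N * rho_star)"
        using labels by (intro mult_mono) auto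
      then show "2 \<le> real CARD('c) * (real N * rho_star)" by simp
    qed (use hbar_pos in simp)
    finally show ?thesis unfolding C by (simp add: mult.assoc)
  qed
  have "basin \<epsilon> Sstar \<subseteq> basin eps_star Sstar \<and>
       (\<forall>k\<^sub>0. S k\<^sub>0 \<in> basin \<epsilon> Sstar \<longrightarrow>
          (\<forall>k>k\<^sub>0. \<exists>\<xi> :: 'v \<Rightarrow> real.
             (\<forall>x. 0 < \<xi> x \<and> \<xi> x < 1) \<and>
             (\<forall>x. l1_norm (S k $ x - Sstar $ x)
                    < \<xi> x ^ (k - k\<^sub>0) * l1_norm (S k\<^sub>0 $ x - Sstar $ x))))"
    if \<epsilon>: "0 < \<epsilon>" and radius: "\<epsilon> \<le> (MIN x. MIN j\<in>- {js x}.
          2 * gap \<Omega> js Sstar x j / (1 + C * rho_star + gap \<Omega> js Sstar x j))" for \<epsilon>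
  proof (intro conjI allI impI)
    have \<epsilon>_le: "\<epsilon> \<le> 2 * gap \<Omega> js Sstar x j / (1 + C * rho_star + gap \<Omega> js Sstar x j)"
      if "j \<noteq> js x" for x j
      using radius nested_Min_le[where js = js and x = x and j = j and f = "\<lambda>x j. 2 * gap \<Omega> js Sstar x j /
          (1 + C * rho_star + gap \<Omega> js Sstar x j)"] that by linarith
    have "\<epsilon> \<le> eps_star"
    proof -
      obtain x j where xj: "j \<noteq> js x"
          "eps_star = 2 * gap \<Omega> js Sstar x j / (1 + gap \<Omega> js Sstar x j)"
        unfolding eps_star_eq by (rule nested_Min_attained[OF labels])
      have "2 * gap \<Omega> js Sstar x j / (1 + C * rho_star + gap \<Omega> js Sstar x j) \<le> eps_star"
        unfolding xj(2) using gap_pos[OF xj(1)] K hbar_pos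
        by (intro divide_left_mono) (auto intro!: mult_pos_pos)
      with \<epsilon>_le[OF xj(1)] show ?thesis by linarith
    qed
    then show "basin \<epsilon> Sstar \<subseteq> basin eps_star Sstar"
      unfolding basin_def by (auto intro: less_le_trans)
    fix k\<^sub>0 k
    assume k\<^sub>0: "S k\<^sub>0 \<in> basin \<epsilon> Sstar" and k: "k\<^sub>0 < k"
    have l1: "l1_norm (S i $ x - Sstar $ x) = 2 * (1 - S i $ x $ js x)" for i x
      unfolding vertex by (rule l1_norm_simplex_axis[OF DC_run_rows(2)[OF run]])
    have near: "2 * (1 - S k\<^sub>0 $ y $ js y) < \<epsilon>" for y
      using k\<^sub>0 by (simp add: basin_def Max_less_iff l1)
    have "S k\<^sub>0 $ x $ js x < S k $ x $ js x" for x
    proof (rule DC_run_dominant_mass_increases[OF run labels _ nonneg Omega_rows vertex _ \<epsilon> _ near k])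
      show "0 < \<gamma>" using gamma by linarith
      show "h k < C * rho_star" for k using h_le[of k] K by linarith
      show "\<epsilon> * (1 + C * rho_star + gap \<Omega> js Sstar x j) \<le> 2 * gap \<Omega> js Sstar x j"
        if "j \<noteq> js x" for x j
        using \<epsilon>_le[OF that] gap_pos[OF that] K hbar_pos by (simp add: pos_le_divide_eq)
    qed
    then have less: "l1_norm (S k $ x - Sstar $ x) < l1_norm (S k\<^sub>0 $ x - Sstar $ x)" for x
      by (simp add: l1)
    have "\<exists>\<xi>. 0 < \<xi> \<and> \<xi> < 1 \<and>
        l1_norm (S k $ x - Sstar $ x) < \<xi> ^ (k - k\<^sub>0) * l1_norm (S k\<^sub>0 $ x - Sstar $ x)" for x
      using less k by (intro strict_decrease_geometric) (auto simp: l1_norm_def sum_nonneg)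
    then show "\<exists>\<xi>. (\<forall>x. 0 < \<xi> x \<and> \<xi> x < 1) \<and> (\<forall>x. l1_norm (S k $ x - Sstar $ x)
        < \<xi> x ^ (k - k\<^sub>0) * l1_norm (S k\<^sub>0 $ x - Sstar $ x))"
      by metis
  qed
  then show ?thesis
    using vertex eps_star_pos hbar_pos rho N_pos by auto
qed

end
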